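(* Let $A$ be a commutative ring with identity. The map $f\mapsto U_f$ is a bijection from the set of idempotents of $A$ onto the set of clopen (both open and closed) subsets of $\operatorname{Sq} A$.
   Context: A proper ideal $\mathfrak{q}$ of $A$ is called quasi-prime if whenever $fg\in\mathfrak{q}$ with $f,g\in A$, then $f\in\sqrt{\mathfrak{q}}$ or $g\in\sqrt{\mathfrak{q}}$. The quasi-prime spectrum $\operatorname{Sq} A$ is the set of all quasi-prime ideals of $A$, with the topology having as basis of opens the sets $U_f=\{\mathfrak{q}\in\operatorname{Sq} A: \mathfrak{q}\cap S_f=\emptyset\}$ for $f\in A$, where $S_f=\{f^i : i\ge 0\}=\{1,f,f^2,\dots\}$. *)

theory Defs
  imports "HOL-Algebra.Ideal" "HOL-Analysis.Abstract_Topology"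
begin

definition ideal_radical :: "('a, 'b) ring_scheme \<Rightarrow> 'a set \<Rightarrow> 'a set"
  where "ideal_radical A I = {f \<in> carrier A. \<exists>n::nat. 0 < n \<and> f [^]\<^bsub>A\<^esub> n \<in> I}"

definition quasi_prime :: "('a, 'b) ring_scheme \<Rightarrow> 'a set \<Rightarrow> bool"
  where "quasi_prime A \<qq> \<longleftrightarrow> ideal \<qq> A \<and> \<qq> \<noteq> carrier A \<and>
    (\<forall>f \<in> carrier A. \<forall>g \<in> carrier A. f \<otimes>\<^bsub>A\<^esub> g \<in> \<qq> \<longrightarrow>
       f \<in> ideal_radical A \<qq> \<or> g \<in> ideal_radical A \<qq>)"

definition Sq :: "('a, 'b) ring_scheme \<Rightarrow> 'a set set"
  where "Sq A = {\<qq>. quasi_prime A \<qq>}"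

definition powers :: "('a, 'b) ring_scheme \<Rightarrow> 'a \<Rightarrow> 'a set"
  where "powers A f = {f [^]\<^bsub>A\<^esub> i | i::nat. True}"

definition Sq_basic_open :: "('a, 'b) ring_scheme \<Rightarrow> 'a \<Rightarrow> 'a set set"
  where "Sq_basic_open A f = {\<qq> \<in> Sq A. \<qq> \<inter> powers A f = {}}"

text \<open>For a commutative ring, \<open>openin_Sq_topology\<close> and \<open>topspace_Sq_topology\<close> below show that
  the argument of \<^term>\<open>topology\<close> satisfies \<^term>\<open>istopology\<close>, so that the basic open sets
  really form a basis of a topology on \<^term>\<open>Sq A\<close>.\<close>

definition Sq_topology :: "('a, 'b) ring_scheme \<Rightarrow> 'a set topology"
  where "Sq_topology A =
    topology (arbitrary union_of (\<lambda>U. \<exists>f \<in> carrier A. U = Sq_basic_open A f))"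

lemma Sq_basic_open_mult:
  assumes "cring A" "f \<in> carrier A" "g \<in> carrier A"
  shows "Sq_basic_open A f \<inter> Sq_basic_open A g = Sq_basic_open A (f \<otimes>\<^bsub>A\<^esub> g)"
proof -
  interpret cring A by fact
  have pow: "(f \<otimes>\<^bsub>A\<^esub> g) [^]\<^bsub>A\<^esub> n = f [^]\<^bsub>A\<^esub> n \<otimes>\<^bsub>A\<^esub> g [^]\<^bsub>A\<^esub> n" for n :: nat
    using assms by (simp add: nat_pow_distrib)
  have *: "\<qq> \<inter> powers A (f \<otimes>\<^bsub>A\<^esub> g) = {} \<longleftrightarrow> \<qq> \<inter> powers A f = {} \<and> \<qq> \<inter> powers A g = {}"
    if q: "quasi_prime A \<qq>" for \<qq>
  proof
    have I: "ideal \<qq> A" using q by (simp add: quasi_prime_def)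
    assume L: "\<qq> \<inter> powers A (f \<otimes>\<^bsub>A\<^esub> g) = {}"
    have "f [^]\<^bsub>A\<^esub> n \<notin> \<qq> \<and> g [^]\<^bsub>A\<^esub> n \<notin> \<qq>" for n :: nat
    proof -
      have "f [^]\<^bsub>A\<^esub> n \<otimes>\<^bsub>A\<^esub> g [^]\<^bsub>A\<^esub> n \<notin> \<qq>"
        using L unfolding powers_def pow[symmetric] by blast
      then show ?thesis
        using ideal.I_l_closed[OF I] ideal.I_r_closed[OF I] assms by blast
    qed
    then show "\<qq> \<inter> powers A f = {} \<and> \<qq> \<inter> powers A g = {}"
      unfolding powers_def by blast
  next
    assume R: "\<qq> \<inter> powers A f = {} \<and> \<qq> \<inter> powers A g = {}"
    have "f [^]\<^bsub>A\<^esub> n \<notin> ideal_radical A \<qq> \<and> g [^]\<^bsub>A\<^esub> n \<notin> ideal_radical A \<qq>" for n :: nat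
      using R assms unfolding ideal_radical_def powers_def by (auto simp: nat_pow_pow)
    then have "(f \<otimes>\<^bsub>A\<^esub> g) [^]\<^bsub>A\<^esub> n \<notin> \<qq>" for n :: nat
      using q assms unfolding quasi_prime_def pow by blast
    then show "\<qq> \<inter> powers A (f \<otimes>\<^bsub>A\<^esub> g) = {}"
      unfolding powers_def by blast
  qed
  show ?thesis
    unfolding Sq_basic_open_def Sq_def using * by blast
qed

lemma Sq_basic_open_one:
  assumes "cring A"
  shows "Sq_basic_open A \<one>\<^bsub>A\<^esub> = Sq A"
proof -
  interpret cring A by fact
  show ?thesis
    unfolding Sq_basic_open_def Sq_def quasi_prime_def powers_def
    by (auto dest: ideal.one_imp_carrier)
qed

lemma openin_Sq_topology:
  assumes "cring A"
  shows "openin (Sq_topology A) =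
    arbitrary union_of (\<lambda>U. \<exists>f \<in> carrier A. U = Sq_basic_open A f)"
proof -
  interpret cring A by fact
  have "istopology (arbitrary union_of (\<lambda>U. \<exists>f \<in> carrier A. U = Sq_basic_open A f))"
    by (rule istopology_base) (metis Sq_basic_open_mult[OF assms] m_closed)
  then show ?thesis
    unfolding Sq_topology_def by (simp add: topology_inverse')
qed

lemma topspace_Sq_topology:
  assumes "cring A"
  shows "topspace (Sq_topology A) = Sq A"
proof -
  interpret cring A by fact
  have "openin (Sq_topology A) (Sq A)"
    unfolding openin_Sq_topology[OF assms]
    by (rule union_of_inc) (auto simp: arbitrary_def Sq_basic_open_one[OF assms, symmetric])
  moreover have "U \<subseteq> Sq A" if "openin (Sq_topology A) U" for U
    using that unfolding openin_Sq_topology[OF assms] union_of_def Sq_basic_open_def by blast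
  ultimately show ?thesis
    by (metis openin_subset openin_topspace subset_antisym)
qed

end

theory Submission
  imports Defs "HOL-Algebra.Ring_Divisibility"
begin

text \<open>Prime ideals are quasi-prime, and there are enough of them: an ideal containing no power of
  \<open>f\<close> lies in a prime ideal avoiding \<open>f\<close>, by Zorn's lemma
  (\<open>exists_prime_avoiding\<close>). An element lying in every prime ideal is therefore nilpotent, and two
  ideals lying in no common prime ideal are comaximal.

  For an idempotent \<open>e\<close> the product \<open>e (1 - e)\<close> vanishes, so a quasi-prime ideal contains
  exactly one of \<open>e\<close> and \<open>1 - e\<close>. This makes \<open>U\<^sub>e\<close> and \<open>U\<^bsub>1 - e\<^esub>\<close>
  complementary open sets. If \<open>U\<^sub>e \<subseteq> U\<^sub>e\<^sub>'\<close>, then the idempotent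
  \<open>e (1 - e')\<close> lies in every prime ideal, so it is nilpotent and thus zero, which gives
  \<open>e = e e'\<close>; by symmetry \<open>e\<close> is determined by \<open>U\<^sub>e\<close>.

  For surjectivity, a clopen set \<open>V\<close> and its complement are covered by basic open sets
  with indices in \<open>F\<close> and \<open>G\<close> respectively. Let \<open>I\<close> and \<open>J\<close> be the ideals that these
  generate. A prime ideal lies in \<open>V\<close> if and only if it does not contain \<open>I\<close>, and likewise outside
  \<open>V\<close> for \<open>J\<close>; so every prime ideal contains exactly one of \<open>I\<close> and \<open>J\<close>. Hence
  \<open>1 = a + b\<close> with \<open>a \<in> I\<close>, \<open>b \<in> J\<close> and \<open>a b\<close> nilpotent, and lifting this decomposition
  gives an idempotent \<open>e \<in> I\<close> with \<open>1 - e \<in> J\<close> (\<open>exists_idempotent_splitting\<close>). A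
  quasi-prime ideal without \<open>e\<close> lies below a prime ideal without \<open>e\<close>, which is in \<open>V\<close>;
  as open sets are closed under passing to smaller points, it is in \<open>V\<close> itself
  (\<open>in_open_if_avoids\<close>). Likewise one without \<open>1 - e\<close> lies outside \<open>V\<close>. The two cases exhaust the spectrum, so \<open>V = U\<^sub>e\<close>.\<close>

section \<open>Prime ideals and idempotents\<close>

lemma (in primeideal) nat_pow_mem_iff:
  assumes "f \<in> carrier R"
  shows "f [^] (n::nat) \<in> I \<longleftrightarrow> f \<in> I \<and> 0 < n"
proof (induction n)
  case 0
  then show ?case using one_imp_carrier I_notcarr by auto
next
  case (Suc n)
  then show ?case
    using assms I_prime[of "f [^] n" f] I_l_closed[of f "f [^] n"] by auto
qed

context cring
begin

lemma mem_add_cgenidealE: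
  assumes "x \<in> M <+>\<^bsub>R\<^esub> PIdl a"
  obtains m r where "m \<in> M" "r \<in> carrier R" "x = m \<oplus> r \<otimes> a"
  using assms unfolding cgenideal_def set_add_def' by auto

lemma ideals_subset_add:
  assumes "ideal I R" "ideal J R"
  shows "I \<subseteq> I <+>\<^bsub>R\<^esub> J" and "J \<subseteq> I <+>\<^bsub>R\<^esub> J"
proof -
  have "I \<union> J \<subseteq> carrier R"
    using ideal.Icarr assms by fast
  then show "I \<subseteq> I <+>\<^bsub>R\<^esub> J" "J \<subseteq> I <+>\<^bsub>R\<^esub> J"
    using genideal_self[of "I \<union> J"] unfolding union_genideal[OF assms] by simp_all
qed

text \<open>An ideal maximal among those containing no power of \<open>f\<close> is prime: enlarging it by either
  factor of a product that it contains produces a power of \<open>f\<close>, and the product of these two powers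
  lies in the ideal itself.\<close>

lemma exists_prime_avoiding:
  assumes I: "ideal I R" and f: "f \<in> carrier R"
    and avoid: "\<And>n::nat. f [^] n \<notin> I"
  obtains P where "primeideal P R" "I \<subseteq> P" "f \<notin> P"
proof -
  define S where "S = {J. ideal J R \<and> I \<subseteq> J \<and> (\<forall>n::nat. f [^] n \<notin> J)}"
  have "\<exists>M\<in>S. \<forall>X\<in>S. M \<subseteq> X \<longrightarrow> X = M"
  proof (rule subset_Zorn_nonempty)
    show "S \<noteq> {}" using I avoid by (auto simp: S_def)
    fix C assume C: "C \<noteq> {}" "subset.chain S C"
    then have "subset.chain {J. ideal J R} C"
      unfolding subset.chain_def S_def by blast
    then have "ideal (\<Union>C) R"
      using chain_Union_is_ideal[of C] C(1) by simp
    then show "\<Union>C \<in> S"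
      using C unfolding subset.chain_def S_def by blast
  qed
  then obtain M where "M \<in> S" and max: "\<And>X. X \<in> S \<Longrightarrow> M \<subseteq> X \<Longrightarrow> X = M"
    by metis
  then have M: "ideal M R" "I \<subseteq> M" "\<And>n::nat. f [^] n \<notin> M"
    by (simp_all add: S_def)
  interpret M: ideal M R by (rule M(1))
  have power: "\<exists>(n::nat) m r. m \<in> M \<and> r \<in> carrier R \<and> f [^] n = m \<oplus> r \<otimes> a"
    if a: "a \<in> carrier R" "a \<notin> M" for a
  proof -
    have sum: "ideal (M <+>\<^bsub>R\<^esub> PIdl a) R"
      using add_ideals[OF M(1)] cgenideal_ideal a by blast
    have sub: "M \<subseteq> M <+>\<^bsub>R\<^esub> PIdl a" "a \<in> M <+>\<^bsub>R\<^esub> PIdl a"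
      using ideals_subset_add[OF M(1) cgenideal_ideal[OF a(1)]] cgenideal_self[OF a(1)] by auto
    then have "M <+>\<^bsub>R\<^esub> PIdl a \<notin> S"
      using max a(2) by blast
    then obtain n :: nat where "f [^] n \<in> M <+>\<^bsub>R\<^esub> PIdl a"
      using sum sub(1) M(2) unfolding S_def by blast
    then show ?thesis
      using mem_add_cgenidealE by metis
  qed
  have "primeideal M R"
  proof (rule primeidealI[OF M(1) is_cring])
    show "carrier R \<noteq> M" using M(3) f by blast
    fix a b assume a: "a \<in> carrier R" and b: "b \<in> carrier R" and ab: "a \<otimes> b \<in> M"
    show "a \<in> M \<or> b \<in> M"
    proof (rule ccontr)
      assume "\<not> (a \<in> M \<or> b \<in> M)"
      then obtain n m :: nat and x y r s where
        x: "x \<in> M" "r \<in> carrier R" "f [^] n = x \<oplus> r \<otimes> a" and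
        y: "y \<in> M" "s \<in> carrier R" "f [^] m = y \<oplus> s \<otimes> b"
        using power a b by metis
      have xc: "x \<in> carrier R" and yc: "y \<in> carrier R"
        using x y M.Icarr by auto
      have "f [^] (n + m) = (x \<oplus> r \<otimes> a) \<otimes> (y \<oplus> s \<otimes> b)"
        using f by (simp add: nat_pow_mult[symmetric] x(3) y(3))
      also have "\<dots> = (x \<otimes> (y \<oplus> s \<otimes> b) \<oplus> (r \<otimes> a) \<otimes> y) \<oplus> (r \<otimes> s) \<otimes> (a \<otimes> b)"
        using a b x(2) y(2) xc yc by algebra
      also have "\<dots> \<in> M"
      proof (intro M.a_closed)
        show "x \<otimes> (y \<oplus> s \<otimes> b) \<in> M"
          using x(1) yc y(2) b by (simp add: M.I_r_closed)
        show "(r \<otimes> a) \<otimes> y \<in> M"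
          using y(1) x(2) a by (simp add: M.I_l_closed)
        show "(r \<otimes> s) \<otimes> (a \<otimes> b) \<in> M"
          using ab x(2) y(2) by (simp add: M.I_l_closed)
      qed
      finally show False using M(3) by blast
    qed
  qed
  moreover have "f \<notin> M" using M(3)[of 1] f by simp
  ultimately show thesis using that M(2) by blast
qed

lemma nilpotent_if_in_all_primes:
  assumes "f \<in> carrier R" "\<And>P. primeideal P R \<Longrightarrow> f \<in> P"
  obtains n :: nat where "f [^] n = \<zero>"
  using exists_prime_avoiding[OF zeroideal assms(1)] assms(2) by blast

lemma comaximal_if_no_common_prime:
  assumes I: "ideal I R" and J: "ideal J R"
    and no_prime: "\<And>P. primeideal P R \<Longrightarrow> I \<subseteq> P \<Longrightarrow> \<not> J \<subseteq> P"
  obtains a b where "a \<in> I" "b \<in> J" "a \<oplus> b = \<one>"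
proof -
  have "\<one> \<in> I <+>\<^bsub>R\<^esub> J"
  proof (rule ccontr)
    assume "\<one> \<notin> I <+>\<^bsub>R\<^esub> J"
    then obtain P where "primeideal P R" "I <+>\<^bsub>R\<^esub> J \<subseteq> P"
      using exists_prime_avoiding[OF add_ideals[OF I J] one_closed] by auto
    then show False using no_prime ideals_subset_add[OF I J] by blast
  qed
  then show thesis using that unfolding set_add_def' by auto
qed

lemma idempotent_nat_pow:
  assumes "e \<in> carrier R" "e \<otimes> e = e" "0 < (n::nat)"
  shows "e [^] n = e"
  using assms(3)
proof (induction n)
  case (Suc n)
  then show ?case using assms by (cases "n = 0") auto
qed simp

lemma idempotent_in_all_primes_zero:
  assumes "e \<in> carrier R" "e \<otimes> e = e" "\<And>P. primeideal P R \<Longrightarrow> e \<in> P"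
  shows "e = \<zero>"
proof -
  obtain n :: nat where "e [^] n = \<zero>"
    using nilpotent_if_in_all_primes assms(1,3) by metis
  then have "e [^] Suc n = \<zero>" using assms(1) by simp
  then show ?thesis using idempotent_nat_pow[OF assms(1,2)] by (metis zero_less_Suc)
qed

text \<open>Idempotents lift modulo the nilradical: if \<open>a + b = 1\<close> and \<open>(a b)\<^sup>n = 0\<close>, then \<open>a\<^sup>n\<close> and
  \<open>b\<^sup>n\<close> are still comaximal, since a prime ideal containing both contains \<open>a + b = 1\<close>. Any
  decomposition of \<open>1\<close> into a multiple of \<open>a\<^sup>n\<close> and a multiple of \<open>b\<^sup>n\<close> is orthogonal, so
  consists of idempotents.\<close>

lemma exists_idempotent_splitting:
  assumes I: "ideal I R" and J: "ideal J R"
    and no_common: "\<And>P. primeideal P R \<Longrightarrow> I \<subseteq> P \<Longrightarrow> \<not> J \<subseteq> P"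
    and cover: "\<And>P. primeideal P R \<Longrightarrow> I \<subseteq> P \<or> J \<subseteq> P"
  obtains e where "e \<in> I" "\<one> \<ominus> e \<in> J" "e \<otimes> e = e"
proof -
  interpret I: ideal I R by (rule I)
  interpret J: ideal J R by (rule J)
  obtain a b where ab: "a \<in> I" "b \<in> J" "a \<oplus> b = \<one>"
    using comaximal_if_no_common_prime[OF I J no_common] by blast
  have a: "a \<in> carrier R" and b: "b \<in> carrier R"
    using ab I.Icarr J.Icarr by auto
  have "a \<otimes> b \<in> P" if "primeideal P R" for P
  proof -
    interpret P: primeideal P R by (rule that)
    show ?thesis
      using cover[OF that] ab a b P.I_l_closed P.I_r_closed by blast
  qed
  then obtain n :: nat where n: "(a \<otimes> b) [^] n = \<zero>"
    using nilpotent_if_in_all_primes[of "a \<otimes> b"] a b by auto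
  \<comment> \<open>The exponent is made positive so that the powers of \<open>a\<close> and \<open>b\<close> stay in the ideals.\<close>
  define N where "N = Suc n"
  have "(a \<otimes> b) [^] N = \<zero>"
    using n a b by (simp add: N_def)
  then have zero: "a [^] N \<otimes> b [^] N = \<zero>"
    using a b by (simp add: nat_pow_distrib)
  have aN: "a [^] N \<in> I" and bN: "b [^] N \<in> J"
    using ab a b by (auto simp: N_def intro: I.I_l_closed J.I_l_closed)
  have comaximal: "\<not> PIdl (b [^] N) \<subseteq> P" if P: "primeideal P R" and aP: "PIdl (a [^] N) \<subseteq> P" for P
  proof
    interpret P: primeideal P R by (rule P)
    assume "PIdl (b [^] N) \<subseteq> P"
    then have "b [^] N \<in> P" "a [^] N \<in> P"
      using aP cgenideal_self[of "b [^] N"] cgenideal_self[of "a [^] N"] a b by auto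
    then have "a \<in> P" "b \<in> P"
      using P.nat_pow_mem_iff a b by auto
    then have "\<one> \<in> P" using ab(3) P.a_closed by metis
    then show False using P.one_imp_carrier P.I_notcarr by blast
  qed
  obtain e e' where e: "e \<in> PIdl (a [^] N)" "e' \<in> PIdl (b [^] N)" "e \<oplus> e' = \<one>"
    using comaximal_if_no_common_prime[OF cgenideal_ideal[OF nat_pow_closed[OF a]]
        cgenideal_ideal[OF nat_pow_closed[OF b]] comaximal] by blast
  then obtain r s where rs: "r \<in> carrier R" "s \<in> carrier R"
    and e_eq: "e = r \<otimes> a [^] N" and e'_eq: "e' = s \<otimes> b [^] N"
    unfolding cgenideal_def by blast
  have ec: "e \<in> carrier R" "e' \<in> carrier R"
    using rs a b e_eq e'_eq by auto
  have eI: "e \<in> I" and e'J: "e' \<in> J"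
    using e_eq e'_eq aN bN rs I.I_l_closed J.I_l_closed by auto
  have "e \<otimes> e' = (r \<otimes> s) \<otimes> (a [^] N \<otimes> b [^] N)"
    unfolding e_eq e'_eq using rs a b by (simp add: m_ac)
  then have orth: "e \<otimes> e' = \<zero>"
    using zero rs by simp
  have "e = e \<otimes> (e \<oplus> e')" using e(3) ec by simp
  also have "\<dots> = e \<otimes> e" using orth ec by (simp add: r_distr)
  finally have idem: "e \<otimes> e = e" by simp
  have "\<one> \<ominus> e = e'" using e(3)[symmetric] ec by algebra
  then show thesis using that eI e'J idem by blast
qed

lemma idempotent_complement:
  assumes "e \<in> carrier R" "e \<otimes> e = e"
  shows "(\<one> \<ominus> e) \<otimes> (\<one> \<ominus> e) = \<one> \<ominus> e" and "e \<otimes> (\<one> \<ominus> e) = \<zero>"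
proof -
  have "(\<one> \<ominus> e) \<otimes> (\<one> \<ominus> e) = \<one> \<ominus> e \<ominus> e \<oplus> e \<otimes> e"
    using assms(1) by algebra
  also have "\<dots> = \<one> \<ominus> e" unfolding assms(2) using assms(1) by algebra
  finally show "(\<one> \<ominus> e) \<otimes> (\<one> \<ominus> e) = \<one> \<ominus> e" .
  have "e \<otimes> (\<one> \<ominus> e) = e \<ominus> e \<otimes> e" using assms(1) by algebra
  then show "e \<otimes> (\<one> \<ominus> e) = \<zero>" using assms by (simp add: r_neg minus_eq)
qed

section \<open>Basic open sets of the quasi-prime spectrum\<close>

lemma mem_Sq_basic_open:
  "\<qq> \<in> Sq_basic_open R f \<longleftrightarrow> \<qq> \<in> Sq R \<and> (\<forall>n::nat. f [^] n \<notin> \<qq>)"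
  unfolding Sq_basic_open_def powers_def by blast

lemma one_notin_Sq:
  assumes "\<qq> \<in> Sq R"
  shows "\<one> \<notin> \<qq>"
  using assms ideal.one_imp_carrier[of \<qq> R] by (auto simp: Sq_def quasi_prime_def)

lemma prime_in_Sq:
  assumes "primeideal P R"
  shows "P \<in> Sq R"
proof -
  interpret P: primeideal P R by (rule assms)
  have "f \<in> ideal_radical R P" if "f \<in> P" for f
    using that P.Icarr unfolding ideal_radical_def by (auto intro!: exI[of _ 1])
  then show ?thesis
    using P.I_notcarr P.I_prime P.is_ideal unfolding Sq_def quasi_prime_def by blast
qed

lemma prime_in_Sq_basic_open_iff:
  assumes "primeideal P R" "f \<in> carrier R"
  shows "P \<in> Sq_basic_open R f \<longleftrightarrow> f \<notin> P"
  using primeideal.nat_pow_mem_iff[OF assms] prime_in_Sq[OF assms(1)]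
  unfolding mem_Sq_basic_open by blast

lemma Sq_basic_open_idempotent:
  assumes "e \<in> carrier R" "e \<otimes> e = e"
  shows "Sq_basic_open R e = {\<qq> \<in> Sq R. e \<notin> \<qq>}"
proof -
  have "(\<forall>n::nat. e [^] n \<notin> \<qq>) \<longleftrightarrow> e \<notin> \<qq>" if "\<qq> \<in> Sq R" for \<qq>
    using idempotent_nat_pow[OF assms] one_notin_Sq[OF that] assms(1)
    by (metis nat_pow_0 nat_pow_eone neq0_conv)
  then show ?thesis unfolding set_eq_iff mem_Sq_basic_open by blast
qed

lemma Sq_basic_open_complement:
  assumes e: "e \<in> carrier R" "e \<otimes> e = e"
  shows "Sq R - Sq_basic_open R e = Sq_basic_open R (\<one> \<ominus> e)"
proof -
  note idem = idempotent_complement[OF e]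
  have c: "\<one> \<ominus> e \<in> carrier R" using e by simp
  have "e \<in> \<qq> \<longleftrightarrow> \<one> \<ominus> e \<notin> \<qq>" if q: "\<qq> \<in> Sq R" for \<qq>
  proof -
    interpret q: ideal \<qq> R using q by (simp add: Sq_def quasi_prime_def)
    have "e \<oplus> (\<one> \<ominus> e) = \<one>" using e(1) by algebra
    then have "\<not> (e \<in> \<qq> \<and> \<one> \<ominus> e \<in> \<qq>)"
      using q.a_closed one_notin_Sq[OF q] by metis
    moreover have "e \<in> ideal_radical R \<qq> \<or> \<one> \<ominus> e \<in> ideal_radical R \<qq>"
      using q e(1) c idem(2) q.zero_closed unfolding Sq_def quasi_prime_def by simp
    then have "e \<in> \<qq> \<or> \<one> \<ominus> e \<in> \<qq>"
      unfolding ideal_radical_def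
      using idempotent_nat_pow[OF e] idempotent_nat_pow[OF c idem(1)] by auto
    ultimately show ?thesis by blast
  qed
  then show ?thesis
    unfolding Sq_basic_open_idempotent[OF e] Sq_basic_open_idempotent[OF c idem(1)] by blast
qed

lemma idempotent_absorbed:
  assumes e: "e \<in> carrier R" "e \<otimes> e = e" and f: "f \<in> carrier R" "f \<otimes> f = f"
    and sub: "Sq_basic_open R e \<subseteq> Sq_basic_open R f"
  shows "e = e \<otimes> f"
proof -
  let ?h = "e \<otimes> (\<one> \<ominus> f)"
  note idem = idempotent_complement[OF f]
  have c: "\<one> \<ominus> f \<in> carrier R" using f by simp
  have "?h \<otimes> ?h = (e \<otimes> e) \<otimes> ((\<one> \<ominus> f) \<otimes> (\<one> \<ominus> f))"
    using e(1) c by (simp add: m_ac)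
  then have hidem: "?h \<otimes> ?h = ?h" using e(2) idem(1) by simp
  have "?h \<in> P" if P: "primeideal P R" for P
  proof -
    interpret P: primeideal P R by (rule P)
    have "e \<in> P \<or> f \<notin> P"
      using sub prime_in_Sq_basic_open_iff[OF P] e f by blast
    moreover have "f \<in> P \<or> \<one> \<ominus> f \<in> P"
      using P.I_prime[OF f(1) c] idem(2) P.zero_closed by simp
    ultimately show ?thesis using e(1) c P.I_l_closed P.I_r_closed by blast
  qed
  then have "?h = \<zero>"
    using idempotent_in_all_primes_zero[OF _ hidem] e(1) c by simp
  then have "e \<otimes> f \<oplus> ?h = e \<otimes> f" using e f by simp
  moreover have "e \<otimes> f \<oplus> ?h = e" using e f by algebra
  ultimately show ?thesis by simp
qed

section \<open>Open sets and the ideals they determine\<close>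

lemma Sq_openE:
  assumes "openin (Sq_topology R) V"
  obtains F where "F \<subseteq> carrier R" "V = (\<Union>f\<in>F. Sq_basic_open R f)"
proof -
  obtain \<U> where U: "\<U> \<subseteq> {U. \<exists>f\<in>carrier R. U = Sq_basic_open R f}" "\<Union>\<U> = V"
    using assms unfolding openin_Sq_topology[OF is_cring] union_of_def by auto
  let ?F = "{f \<in> carrier R. Sq_basic_open R f \<in> \<U>}"
  have "V = (\<Union>f\<in>?F. Sq_basic_open R f)" using U by blast
  then show thesis using that[of ?F] by blast
qed

lemma prime_in_open_iff:
  assumes P: "primeideal P R" and F: "F \<subseteq> carrier R"
  shows "P \<in> (\<Union>f\<in>F. Sq_basic_open R f) \<longleftrightarrow> \<not> Idl F \<subseteq> P"
proof -
  have "Idl F \<subseteq> P \<longleftrightarrow> F \<subseteq> P"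
    using genideal_minimal[of P F] genideal_self[OF F] primeideal.axioms(1)[OF P] by blast
  then show ?thesis
    using prime_in_Sq_basic_open_iff[OF P] F by blast
qed

text \<open>The criterion above for prime ideals reaches an arbitrary point \<open>\<qq>\<close> because a basic open set
  containing a prime ideal also contains every quasi-prime ideal inside it: choose a prime ideal
  above \<open>\<qq>\<close> that avoids \<open>x\<close>.\<close>

lemma in_open_if_avoids:
  assumes F: "F \<subseteq> carrier R" and x: "x \<in> Idl F"
    and q: "\<qq> \<in> Sq_basic_open R x"
  shows "\<qq> \<in> (\<Union>f\<in>F. Sq_basic_open R f)"
proof -
  have "ideal \<qq> R" using q unfolding mem_Sq_basic_open Sq_def quasi_prime_def by blast
  moreover have "x \<in> carrier R"
    using x ideal.Icarr[OF genideal_ideal[OF F]] by blast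
  ultimately obtain P where P: "primeideal P R" "\<qq> \<subseteq> P" "x \<notin> P"
    using exists_prime_avoiding q unfolding mem_Sq_basic_open by metis
  then obtain f where "f \<in> F" and f: "P \<in> Sq_basic_open R f"
    using prime_in_open_iff[OF P(1) F] x by blast
  have "f [^] n \<notin> \<qq>" for n :: nat
    using f P(2) by (auto simp: mem_Sq_basic_open)
  then have "\<qq> \<in> Sq_basic_open R f"
    using q by (simp add: mem_Sq_basic_open)
  then show ?thesis using \<open>f \<in> F\<close> by blast
qed

lemma clopen_eq_idempotent_basic_open:
  assumes V: "openin (Sq_topology R) V" "closedin (Sq_topology R) V"
  obtains e where "e \<in> carrier R" "e \<otimes> e = e" "V = Sq_basic_open R e"
proof -
  have W: "openin (Sq_topology R) (Sq R - V)" and VS: "V \<subseteq> Sq R"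
    using V by (simp_all add: closedin_def topspace_Sq_topology[OF is_cring])
  obtain F where F: "F \<subseteq> carrier R" "V = (\<Union>f\<in>F. Sq_basic_open R f)"
    using Sq_openE[OF V(1)] .
  obtain G where G: "G \<subseteq> carrier R" "Sq R - V = (\<Union>g\<in>G. Sq_basic_open R g)"
    using Sq_openE[OF W] .
  have dichotomy: "Idl F \<subseteq> P \<longleftrightarrow> \<not> Idl G \<subseteq> P" if P: "primeideal P R" for P
    using prime_in_open_iff[OF P F(1)] prime_in_open_iff[OF P G(1)] prime_in_Sq[OF P]
    unfolding F(2)[symmetric] G(2)[symmetric] by blast
  obtain e where e: "e \<in> Idl F" "\<one> \<ominus> e \<in> Idl G" "e \<otimes> e = e"
  proof (rule exists_idempotent_splitting[OF genideal_ideal[OF F(1)] genideal_ideal[OF G(1)]])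
    show "\<not> Idl G \<subseteq> P" if "primeideal P R" "Idl F \<subseteq> P" for P
      using dichotomy that by simp
    show "Idl F \<subseteq> P \<or> Idl G \<subseteq> P" if "primeideal P R" for P
      using dichotomy[OF that] by simp
  qed
  have ec: "e \<in> carrier R"
    using e(1) ideal.Icarr[OF genideal_ideal[OF F(1)]] by blast
  have "Sq_basic_open R e \<subseteq> V"
    using in_open_if_avoids[OF F(1) e(1)] F(2) by blast
  moreover have "Sq R - Sq_basic_open R e \<subseteq> Sq R - V"
    using in_open_if_avoids[OF G(1) e(2)] G(2) Sq_basic_open_complement[OF ec e(3)] by blast
  ultimately have "V = Sq_basic_open R e" using VS by blast
  then show thesis using that ec e(3) by blast
qed

lemma Sq_basic_open_openin:
  assumes "f \<in> carrier R"
  shows "openin (Sq_topology R) (Sq_basic_open R f)"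
  unfolding openin_Sq_topology[OF is_cring]
  by (rule union_of_inc) (use assms in \<open>auto simp: arbitrary_def\<close>)

end

theorem proposition3p3:
  fixes A :: "('a, 'b) ring_scheme"
  assumes "cring A"
  shows "bij_betw (Sq_basic_open A)
           {f \<in> carrier A. f \<otimes>\<^bsub>A\<^esub> f = f}
           {V. openin (Sq_topology A) V \<and> closedin (Sq_topology A) V}"
proof -
  interpret cring A by fact
  have "e = f"
    if e: "e \<in> carrier A" "e \<otimes>\<^bsub>A\<^esub> e = e" and f: "f \<in> carrier A" "f \<otimes>\<^bsub>A\<^esub> f = f"
      and eq: "Sq_basic_open A e = Sq_basic_open A f" for e f
  proof -
    have "e = e \<otimes>\<^bsub>A\<^esub> f" by (rule idempotent_absorbed[OF e f]) (simp add: eq)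
    also have "\<dots> = f \<otimes>\<^bsub>A\<^esub> e" by (rule m_comm[OF e(1) f(1)])
    also have "\<dots> = f" by (rule idempotent_absorbed[OF f e, symmetric]) (simp add: eq)
    finally show ?thesis .
  qed
  then have "inj_on (Sq_basic_open A) {f \<in> carrier A. f \<otimes>\<^bsub>A\<^esub> f = f}"
    unfolding inj_on_def by blast
  moreover have "openin (Sq_topology A) (Sq_basic_open A e) \<and>
      closedin (Sq_topology A) (Sq_basic_open A e)"
    if e: "e \<in> carrier A" "e \<otimes>\<^bsub>A\<^esub> e = e" for e
  proof -
    have "\<one>\<^bsub>A\<^esub> \<ominus>\<^bsub>A\<^esub> e \<in> carrier A" using e by simp
    then have "openin (Sq_topology A) (Sq A - Sq_basic_open A e)"
      using Sq_basic_open_complement[OF e] Sq_basic_open_openin by simp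
    moreover have "Sq_basic_open A e \<subseteq> Sq A" unfolding Sq_basic_open_def by blast
    ultimately show ?thesis
      using Sq_basic_open_openin[OF e(1)]
      by (simp add: closedin_def topspace_Sq_topology[OF assms])
  qed
  moreover have "V \<in> Sq_basic_open A ` {f \<in> carrier A. f \<otimes>\<^bsub>A\<^esub> f = f}"
    if "openin (Sq_topology A) V" "closedin (Sq_topology A) V" for V
    by (rule clopen_eq_idempotent_basic_open[OF that]) blast
  ultimately show ?thesis
    unfolding bij_betw_def by blast
qed

end
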